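(* Let $2\le n<d$ be integers with $d$ prime and let $(M,d)$ be a system of congruences $$y_0+y_1+\cdots+y_n\equiv0\pmod d,\qquad a_{1,1}y_1+\cdots+a_{1,n}y_n\equiv0\pmod d,$$ with integers $0<a_{1,1}<\cdots<a_{1,n}<d$. Let $\mathcal{A}\subset\mathbb{Z}_{\ge0}^n$ be the $GT$-subset associated to $(M,d)$. Then the phase transition $n_0(\mathcal{A})$ is zero and, for all $t\ge0$, $$\varphi_{\mathcal{A}}(t)=p_{\mathcal{A}}(t)=\frac1d\binom{td+n}{n}+\frac{d-1}{d}.$$
   Context: The $GT$-subset of $(M,d)$ is $\mathcal{A}=\{(y_1,\ldots,y_n)\mid(y_0,y_1,\ldots,y_n)\in\mathbb{Z}_{\ge0}^{n+1},\ y_0+\cdots+y_n=d,\ a_{1,1}y_1+\cdots+a_{1,n}y_n\equiv0\pmod d\}\subset\mathbb{Z}_{\ge0}^n$. For $t\ge1$, $t\mathcal{A}$ is the set of sums of $t$ (not necessarily distinct) elements of $\mathcal{A}$, $0\mathcal{A}=\{0\}$, and $\varphi_{\mathcal{A}}(t)=|t\mathcal{A}|$. There is a polynomial $p_{\mathcal{A}}\in\mathbb{Q}[t]$ with $\varphi_{\mathcal{A}}(t)=p_{\mathcal{A}}(t)$ for $t\gg0$ (Khovanskii), and the phase transition is $n_0(\mathcal{A})=\min\{n_0\in\mathbb{Z}_{\ge0}\mid\varphi_{\mathcal{A}}(t)=p_{\mathcal{A}}(t)\ \forall t\ge n_0\}$. *)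

theory Defs
  imports
    "HOL-Library.Function_Algebras"
    "HOL-Computational_Algebra.Computational_Algebra"
    "HOL-Number_Theory.Cong"
begin

text \<open>
  A vector \<open>(y\<^sub>1, \<dots>, y\<^sub>n)\<close> of natural numbers is represented by a function \<open>y :: nat \<Rightarrow> nat\<close> that
  vanishes outside \<open>{1..n}\<close>; addition of such functions is pointwise (\<open>Function_Algebras\<close>).
\<close>

definition GT_subset :: "nat \<Rightarrow> nat \<Rightarrow> (nat \<Rightarrow> int) \<Rightarrow> (nat \<Rightarrow> nat) set" where
  "GT_subset n d a =
     {y. (\<forall>i. i \<notin> {1..n} \<longrightarrow> y i = 0) \<and>
         (\<exists>y0. y0 + (\<Sum>i=1..n. y i) = d) \<and>
         [(\<Sum>i=1..n. a i * int (y i)) = 0] (mod (int d))}"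

definition sumset :: "nat \<Rightarrow> 'a::comm_monoid_add set \<Rightarrow> 'a set" where
  "sumset t A = {sum_list xs |xs. length xs = t \<and> set xs \<subseteq> A}"

lemma sumset_0: "sumset 0 A = {0}"
  by (auto simp: sumset_def)

definition sumset_card :: "'a::comm_monoid_add set \<Rightarrow> nat \<Rightarrow> nat" where
  "sumset_card A t = card (sumset t A)"

text \<open>
  For finite \<open>A\<close> a polynomial as below exists by Khovanskii's theorem; it is unique by the lemma
  that follows.
\<close>

definition sumset_poly :: "'a::comm_monoid_add set \<Rightarrow> rat poly" where
  "sumset_poly A =
     (THE p. \<forall>\<^sub>F t in sequentially. of_nat (sumset_card A t) = poly p (of_nat t))"

lemma sumset_poly_unique:
  fixes p q :: "rat poly"
  assumes "\<forall>\<^sub>F t in sequentially. of_nat (sumset_card A t) = poly p (of_nat t)"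
    and "\<forall>\<^sub>F t in sequentially. of_nat (sumset_card A t) = poly q (of_nat t)"
  shows "p = q"
proof (rule ccontr)
  assume "p \<noteq> q"
  then have fin: "finite {x. poly (p - q) x = 0}"
    by (intro poly_roots_finite) simp
  have "\<forall>\<^sub>F t in sequentially. poly (p - q) (of_nat t) = 0"
    using assms by eventually_elim simp
  then obtain N where N: "\<And>t. t \<ge> N \<Longrightarrow> poly (p - q) (of_nat t) = 0"
    by (auto simp: eventually_sequentially)
  have "of_nat ` {N..} \<subseteq> {x. poly (p - q) x = 0}"
    using N by auto
  with fin have "finite ((of_nat :: nat \<Rightarrow> rat) ` {N..})"
    by (rule rev_finite_subset)
  then have "finite {N..}"
    by (rule finite_imageD) (simp add: inj_on_def)
  then show False
    by (simp add: infinite_Ici)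
qed

definition phase_transition :: "'a::comm_monoid_add set \<Rightarrow> nat" where
  "phase_transition A =
     (LEAST n0. \<forall>t\<ge>n0. of_nat (sumset_card A t) = poly (sumset_poly A) (of_nat t))"

end

theory Submission
  imports Defs
begin

text \<open>
  Homogenize: a point \<open>(y\<^sub>1, \<dots>, y\<^sub>n)\<close> together with \<open>y\<^sub>0\<close> is a multiset of indices in \<open>{0..n}\<close>, where
  the index \<open>0\<close> has weight \<open>0\<close> and the index \<open>i \<ge> 1\<close> has weight \<open>a i\<close>. The GT-subset corresponds to
  the multisets of size \<open>d\<close> whose weight is divisible by \<open>d\<close>. Two facts then determine the growth function.

  First, the \<open>t\<close>-fold sums are exactly the multisets of size \<open>t * d\<close> with weight divisible by \<open>d\<close>
  (\<open>sumset_zero_weight_multisets\<close>). Decomposing such a multiset into \<open>t\<close> pieces is possible by the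
  theorem of Erdos, Ginzburg and Ziv: among any \<open>2 * d - 1\<close> integers there are \<open>d\<close> whose sum is
  divisible by \<open>d\<close>. For prime \<open>d\<close> this follows from the Cauchy--Davenport inequality for two-element
  sets (\<open>card_choice_sums_ge\<close>, \<open>erdos_ginzburg_ziv_prime\<close>).

  Second, these multisets are counted by averaging over the \<open>d\<close>-th roots of unity \<open>\<zeta>\<close>
  (\<open>card_zero_weight_multisets\<close>). The sum of \<open>\<zeta>\<close> to the power of the weight, over all multisets of
  size \<open>t * d\<close>, is the complete homogeneous symmetric polynomial of degree \<open>t * d\<close> in \<open>\<zeta> ^ b i\<close>,
  \<open>0 \<le> i \<le> n\<close>, where \<open>b i\<close> is the weight of \<open>i\<close>. For \<open>\<zeta> = 1\<close> it is the binomial coefficient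
  \<open>t * d + n choose n\<close>. For \<open>\<zeta> \<noteq> 1\<close> the \<open>\<zeta> ^ b i\<close> are distinct \<open>d\<close>-th roots of unity and its
  value is \<open>1\<close>, because the generating function is a polynomial of degree less than \<open>d\<close> with constant
  term \<open>1\<close> divided by \<open>1 - X ^ d\<close> (\<open>complete_homogeneous_distinct_roots_unity\<close>). So \<open>d\<close> times the
  number of \<open>t\<close>-fold sums is \<open>(t * d + n choose n) + (d - 1)\<close> for every \<open>t\<close>, including \<open>t = 0\<close>. This is
  a polynomial in \<open>t\<close>, so it is the one that describes the growth eventually, and it does so from
  \<open>t = 0\<close> on.
\<close>

section \<open>Zero-sum subfamilies modulo a prime\<close>

text \<open>
  Every nonzero class generates the additive group modulo a prime, so a nonempty set of residues
  that is stable under translation by such a class is the whole group.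
\<close>

lemma exists_translate_not_mem:
  fixes p :: nat and B :: "int set" and c :: int
  assumes p: "prime p" and B: "B \<subseteq> {0..<int p}" "B \<noteq> {}" "B \<noteq> {0..<int p}"
    and c: "\<not> int p dvd c"
  obtains x where "x \<in> B" "(x + c) mod int p \<notin> B"
proof -
  have False if closed: "\<And>x. x \<in> B \<Longrightarrow> (x + c) mod int p \<in> B"
  proof -
    have p0: "int p > 0" using p by (simp add: prime_gt_0_nat)
    obtain x where x: "x \<in> B" using B by auto
    \<comment> \<open>The orbit of \<open>x\<close> under translation by \<open>c\<close> stays in \<open>B\<close>, and it reaches every residue.\<close>
    have orbit: "(x + int k * c) mod int p \<in> B" for k
    proof (induction k)
      case 0
      then show ?case using x B by auto
    next
      case (Suc k)
      have "(x + int (Suc k) * c) mod int p = ((x + int k * c) mod int p + c) mod int p"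
        by (simp add: mod_add_right_eq algebra_simps)
      with closed[OF Suc.IH] show ?case by simp
    qed
    have "coprime c (int p)"
      using p c by (metis coprime_commute prime_imp_coprime prime_nat_int_transfer)
    then obtain e where e: "[c * e = 1] (mod int p)"
      using cong_solve_coprime_int by blast
    have "y \<in> B" if y: "y \<in> {0..<int p}" for y
    proof -
      define k where "k = nat (((y - x) * e) mod int p)"
      have k: "int k = ((y - x) * e) mod int p" using p0 by (simp add: k_def)
      have "[int k * c = (y - x) * e * c] (mod int p)"
        unfolding k by (simp add: cong_def mod_mult_left_eq)
      also have "(y - x) * e * c = (y - x) * (c * e)" by simp
      also have "[\<dots> = (y - x) * 1] (mod int p)"
        using e by (rule cong_scalar_left)
      finally have "[x + int k * c = x + (y - x) * 1] (mod int p)"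
        by (intro cong_add) auto
      then have "(x + int k * c) mod int p = y"
        using y by (simp add: cong_def)
      with orbit show ?thesis by metis
    qed
    with B show False by blast
  qed
  then show thesis using that by blast
qed

text \<open>
  This is the Cauchy--Davenport inequality for the sum of \<open>m\<close> two-element sets
  \<open>{f j, g j}\<close> modulo \<open>p\<close>. Adjoining one more pair replaces the set of sums by the union of two
  translates of it, one of which leaves the other unless all residues are already reached.
\<close>

lemma card_choice_sums_ge:
  fixes p m :: nat and f g :: "nat \<Rightarrow> int"
  assumes p: "prime p" and "\<And>j. j < m \<Longrightarrow> \<not> int p dvd f j - g j"
  shows "min p (m + 1) \<le> card (range (\<lambda>s. (\<Sum>j<m. if s j then f j else g j) mod int p))"
    (is "_ \<le> card (range (?S m))")
  using assms(2)
proof (induction m)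
  case 0
  then show ?case by simp
next
  case (Suc m)
  have p0: "int p > 0" using p by (simp add: prime_gt_0_nat)
  define B where "B = range (?S m)"
  define C where "C = (\<lambda>x. (x + g m) mod int p) ` B"
  have IH: "min p (m + 1) \<le> card B"
    unfolding B_def using Suc by simp
  have Bsub: "B \<subseteq> {0..<int p}" using p0 by (auto simp: B_def)
  have Csub: "C \<subseteq> {0..<int p}" using p0 by (auto simp: C_def)
  have finC: "finite C" using Csub finite_subset by blast
  have "inj_on (\<lambda>x. (x + g m) mod int p) B"
  proof (rule inj_onI)
    fix x y assume xy: "x \<in> B" "y \<in> B" "(x + g m) mod int p = (y + g m) mod int p"
    then have "[x = y] (mod int p)" by (simp add: cong_def[symmetric] cong_add_rcancel)
    moreover have "x mod int p = x" "y mod int p = y"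
      using xy(1,2) Bsub by (auto intro!: mod_pos_pos_trivial)
    ultimately show "x = y" by (simp add: cong_def)
  qed
  then have cardC: "card C = card B" unfolding C_def by (rule card_image)
  have choose: "?S (Suc m) (s(m := b)) = (?S m s + (if b then f m else g m)) mod int p" for s b
  proof -
    have "(\<Sum>j<m. if (s(m := b)) j then f j else g j) = (\<Sum>j<m. if s j then f j else g j)"
      by (intro sum.cong) auto
    then show ?thesis by (simp add: mod_add_left_eq)
  qed
  have C_le: "C \<subseteq> range (?S (Suc m))"
  proof
    fix y assume "y \<in> C"
    then obtain s where "y = (?S m s + g m) mod int p" by (auto simp: C_def B_def)
    with choose[of s False] have "y = ?S (Suc m) (s(m := False))" by simp
    then show "y \<in> range (?S (Suc m))" by blast
  qed
  have C_shift: "(y + (f m - g m)) mod int p \<in> range (?S (Suc m))" if "y \<in> C" for y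
  proof -
    from that obtain s where "y = (?S m s + g m) mod int p" by (auto simp: C_def B_def)
    then have "(y + (f m - g m)) mod int p = (?S m s + f m) mod int p"
      by (simp add: mod_add_left_eq)
    with choose[of s True] have "(y + (f m - g m)) mod int p = ?S (Suc m) (s(m := True))" by simp
    then show ?thesis by blast
  qed
  have fin: "finite (range (?S (Suc m)))"
    by (rule finite_subset[of _ "{0..<int p}"]) (use p0 in auto)
  show ?case
  proof (cases "C = {0..<int p}")
    case True
    then have "p \<le> card (range (?S (Suc m)))"
      using card_mono[OF fin C_le] by simp
    then show ?thesis by linarith
  next
    case False
    have "C \<noteq> {}" by (auto simp: C_def B_def)
    then obtain y where y: "y \<in> C" "(y + (f m - g m)) mod int p \<notin> C"
      using exists_translate_not_mem[OF p Csub _ False, of "f m - g m"] Suc.prems by blast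
    then have "card C + 1 = card (insert ((y + (f m - g m)) mod int p) C)"
      using finC by simp
    also have "\<dots> \<le> card (range (?S (Suc m)))"
      using C_le C_shift[OF y(1)] by (intro card_mono[OF fin]) auto
    finally show ?thesis using IH cardC by linarith
  qed
qed

text \<open>
  Arrange \<open>2 * p - 1\<close> of the elements by residue and pair the one in position \<open>j\<close> with the one in
  position \<open>j + (p - 1)\<close>, for \<open>j < p - 1\<close>; the last element stays unpaired. If some pair has equal
  residues, then so do the \<open>p\<close> elements from \<open>j\<close> to \<open>j + (p - 1)\<close>, and their sum vanishes
  modulo \<open>p\<close>. Otherwise the \<open>p - 1\<close> pairs are all genuine two-element sets, so choosing one
  element from each produces every residue, in particular the negative of the unpaired element.
\<close>

theorem erdos_ginzburg_ziv_prime: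
  fixes p :: nat and f :: "'a \<Rightarrow> int"
  assumes p: "prime p" and fin: "finite A" and A: "2 * p - 1 \<le> card A"
  obtains I where "I \<subseteq> A" "card I = p" "int p dvd sum f I"
proof -
  note result = that
  have p0: "int p > 0" and p1: "p \<ge> 1" using p by (simp_all add: prime_gt_0_nat Suc_leI)
  define key where "key x = f x mod int p" for x
  obtain ys where ys: "set ys = A" "distinct ys" using fin finite_distinct_list by blast
  define xs where "xs = sort_key key ys"
  have xs: "set xs = A" "distinct xs" "sorted (map key xs)"
    using ys by (simp_all add: xs_def)
  have len: "length xs = card A" using xs by (metis distinct_card)
  have key_mono: "key (xs ! i) \<le> key (xs ! j)" if "i \<le> j" "j < length xs" for i j
    using sorted_nth_mono[OF xs(3), of i j] that by simp
  have pick: thesis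
    if "inj_on h {..<p}" "h ` {..<p} \<subseteq> {..<length xs}"
      and dv: "int p dvd (\<Sum>j<p. f (xs ! h j))" for h
  proof -
    have "inj_on ((!) xs) {..<length xs}" using xs(2) by (simp add: inj_on_nth)
    then have inj: "inj_on (\<lambda>j. xs ! h j) {..<p}"
      using that(1,2) by (auto simp: inj_on_def image_subset_iff)
    show thesis
    proof (rule result)
      show "(\<lambda>j. xs ! h j) ` {..<p} \<subseteq> A" using that(2) xs(1) by (auto simp: set_conv_nth)
      show "card ((\<lambda>j. xs ! h j) ` {..<p}) = p" using card_image[OF inj] by simp
      show "int p dvd sum f ((\<lambda>j. xs ! h j) ` {..<p})"
        using dv by (simp add: sum.reindex[OF inj])
    qed
  qed
  show thesis
  proof (cases "\<exists>j<p - 1. key (xs ! j) = key (xs ! (j + (p - 1)))")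
    case True
    then obtain j where j: "j < p - 1" "key (xs ! j) = key (xs ! (j + (p - 1)))" by auto
    have const: "[f (xs ! (j + i)) = f (xs ! j)] (mod int p)" if "i < p" for i
    proof -
      have "key (xs ! j) \<le> key (xs ! (j + i))" "key (xs ! (j + i)) \<le> key (xs ! (j + (p - 1)))"
        using that j A len by (intro key_mono; simp)+
      with j show ?thesis by (simp add: cong_def key_def)
    qed
    have "[(\<Sum>i<p. f (xs ! (j + i))) = (\<Sum>i<p. f (xs ! j))] (mod int p)"
      using const by (intro cong_sum) auto
    then have "int p dvd (\<Sum>i<p. f (xs ! (j + i)))"
      by (simp add: cong_dvd_iff)
    then show thesis
      using j A len by (intro pick[of "\<lambda>i. j + i"]) auto
  next
    case False
    define m where "m = p - 1"
    have pm: "p = Suc m" using p1 by (simp add: m_def)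
    let ?S = "\<lambda>s. (\<Sum>j<m. if s j then f (xs ! (j + m)) else f (xs ! j))"
    have "\<not> int p dvd f (xs ! (j + m)) - f (xs ! j)" if "j < m" for j
      using False that unfolding m_def key_def mod_eq_dvd_iff[symmetric] by metis
    then have "min p (m + 1) \<le> card (range (\<lambda>s. ?S s mod int p))"
      by (intro card_choice_sums_ge[OF p]) auto
    then have "card {0..<int p} \<le> card (range (\<lambda>s. ?S s mod int p))"
      using pm by simp
    then have "range (\<lambda>s. ?S s mod int p) = {0..<int p}"
      using p0 by (intro card_seteq) auto
    moreover have "(- f (xs ! (2 * m))) mod int p \<in> {0..<int p}" using p0 by simp
    ultimately have "\<exists>s. ?S s mod int p = (- f (xs ! (2 * m))) mod int p"
      by (metis (no_types, lifting) imageE)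
    then obtain s where s: "?S s mod int p = (- f (xs ! (2 * m))) mod int p"
      by blast
    \<comment> \<open>Position \<open>2 * m\<close> holds the unpaired element; \<open>s\<close> says which half of each pair is taken.\<close>
    define h where "h j = (if j = m then 2 * m else if s j then j + m else j)" for j
    have "(\<Sum>j<p. f (xs ! h j)) = (\<Sum>j<m. f (xs ! h j)) + f (xs ! (2 * m))"
      by (simp add: pm h_def)
    also have "(\<Sum>j<m. f (xs ! h j)) = ?S s"
      by (intro sum.cong) (auto simp: h_def)
    finally have "int p dvd (\<Sum>j<p. f (xs ! h j))"
      using s by (simp add: mod_eq_dvd_iff)
    moreover have "inj_on h {..<p}"
      by (auto simp: inj_on_def h_def pm split: if_splits)
    moreover have "h ` {..<p} \<subseteq> {..<length xs}"
      using A len by (auto simp: h_def pm)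
    ultimately show thesis by (intro pick)
  qed
qed

text \<open>
  Multiplicities are handled by applying the theorem to the positions of an enumeration of \<open>M\<close>.
\<close>

lemma erdos_ginzburg_ziv_prime_mset:
  fixes p :: nat and f :: "'a \<Rightarrow> int"
  assumes p: "prime p" and M: "2 * p - 1 \<le> size M"
  obtains N where "N \<subseteq># M" "size N = p" "int p dvd (\<Sum>x\<in>#N. f x)"
proof -
  obtain xs where xs: "mset xs = M" using ex_mset by blast
  then have len: "length xs = size M" by auto
  obtain I where I: "I \<subseteq> {..<length xs}" "card I = p" "int p dvd (\<Sum>i\<in>I. f (xs ! i))"
    using erdos_ginzburg_ziv_prime[OF p, of "{..<length xs}" "\<lambda>i. f (xs ! i)"] M len by auto
  have finI: "finite I" using I(1) finite_subset by blast
  let ?N = "image_mset ((!) xs) (mset_set I)"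
  have "M = image_mset ((!) xs) (mset_set {..<length xs})"
    using xs by (metis map_nth mset_map mset_upt atLeast0LessThan)
  moreover have "mset_set I \<subseteq># mset_set {..<length xs}"
    using I(1) finI by (simp)
  ultimately have "?N \<subseteq># M" by (metis image_mset_subseteq_mono)
  moreover have "size ?N = p" using I(2) by simp
  moreover have "int p dvd (\<Sum>x\<in>#?N. f x)"
    using I(3) by (simp add: sum_unfold_sum_mset multiset.map_comp comp_def)
  ultimately show thesis by (rule that)
qed

section \<open>Counting multisets by weight\<close>

text \<open>
  The complete homogeneous symmetric polynomial \<open>h\<^sub>D\<close> in the variables \<open>z i\<close>, \<open>i \<in> I\<close>. Its
  monomials are indexed by multisets, so that at \<open>z i = \<zeta> ^ b i\<close> it becomes the sum of
  \<open>\<zeta>\<close>-powers of weights of multisets.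
\<close>

definition complete_homogeneous :: "('a \<Rightarrow> 'b::comm_semiring_1) \<Rightarrow> 'a set \<Rightarrow> nat \<Rightarrow> 'b" where
  "complete_homogeneous z I D = (\<Sum>M\<in>multisets_of_size I D. \<Prod>i\<in>#M. z i)"

lemma complete_homogeneous_0 [simp]: "complete_homogeneous z I 0 = 1"
  by (simp add: complete_homogeneous_def)

text \<open>
  Either the new variable does not occur in a monomial, or one copy of it can be split off.
\<close>

lemma complete_homogeneous_insert:
  assumes "finite I" "i \<notin> I"
  shows "complete_homogeneous z (insert i I) (Suc D) =
    complete_homogeneous z I (Suc D) + z i * complete_homogeneous z (insert i I) D"
proof -
  let ?J = "insert i I"
  have split: "multisets_of_size ?J (Suc D) =
      multisets_of_size I (Suc D) \<union> add_mset i ` multisets_of_size ?J D"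
  proof (intro set_eqI iffI)
    fix M assume M: "M \<in> multisets_of_size ?J (Suc D)"
    show "M \<in> multisets_of_size I (Suc D) \<union> add_mset i ` multisets_of_size ?J D"
    proof (cases "i \<in># M")
      case True
      then obtain N where "M = add_mset i N" by (meson multi_member_split)
      with M show ?thesis by (auto simp: multisets_of_size_def)
    next
      case False
      with M show ?thesis by (auto simp: multisets_of_size_def)
    qed
  qed (auto simp: multisets_of_size_def)
  have disj: "multisets_of_size I (Suc D) \<inter> add_mset i ` multisets_of_size ?J D = {}"
    using assms(2) by (auto simp: multisets_of_size_def)
  have inj: "inj_on (add_mset i) (multisets_of_size ?J D)"
    by (simp add: inj_on_def)
  show ?thesis
    unfolding complete_homogeneous_def split
    using assms(1) disj
    by (subst sum.union_disjoint)
       (auto simp: sum.reindex[OF inj] sum_distrib_left intro: finite_imageI)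
qed

text \<open>
  The generating function of the \<open>h\<^sub>D\<close> is \<open>\<Prod>i\<in>I. 1 / (1 - z i * X)\<close>; the recurrence above is the
  statement that adding a variable contributes one such factor.
\<close>

lemma complete_homogeneous_fps:
  fixes z :: "'a \<Rightarrow> 'b::comm_ring_1"
  assumes "finite I"
  shows "Abs_fps (complete_homogeneous z I) * fps_of_poly (\<Prod>i\<in>I. [:1, - z i:]) = 1"
  using assms
proof (induction I)
  case empty
  have "complete_homogeneous z {} D = (if D = 0 then 1 else 0)" for D
    by (cases "D = 0") (simp_all add: complete_homogeneous_def)
  then show ?case by (simp add: fps_eq_iff)
next
  case (insert i I)
  have "Abs_fps (complete_homogeneous z (insert i I)) * fps_of_poly [:1, - z i:]
      = Abs_fps (complete_homogeneous z I)"
  proof (rule fps_ext)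
    fix D
    have linear: "fps_of_poly [:1, - z i:] = 1 - fps_const (z i) * fps_X"
      by (simp add: fps_of_poly_pCons fps_of_poly_const)
    have "Abs_fps (complete_homogeneous z (insert i I)) * fps_of_poly [:1, - z i:]
        = Abs_fps (complete_homogeneous z (insert i I))
          - fps_const (z i) * (fps_X * Abs_fps (complete_homogeneous z (insert i I)))"
      by (simp only: linear right_diff_distrib mult_1_left mult_1_right mult_ac)
    then show "(Abs_fps (complete_homogeneous z (insert i I)) * fps_of_poly [:1, - z i:]) $ D
        = Abs_fps (complete_homogeneous z I) $ D"
      using insert.hyps by (cases D) (simp_all add: complete_homogeneous_insert)
  qed
  then have "Abs_fps (complete_homogeneous z (insert i I)) * fps_of_poly (\<Prod>i\<in>insert i I. [:1, - z i:])
      = Abs_fps (complete_homogeneous z I) * fps_of_poly (\<Prod>i\<in>I. [:1, - z i:])"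
    by (simp only: prod.insert[OF insert.hyps] fps_of_poly_mult flip: mult.assoc)
  with insert.IH show ?case by simp
qed

text \<open>
  Both sides have degree at most \<open>d\<close> and agree at the \<open>d\<close> roots of unity and at \<open>0\<close>.
\<close>

lemma prod_one_minus_roots_unity:
  assumes d: "d > 0"
  shows "(\<Prod>\<zeta> | \<zeta> ^ d = 1. [:1, - \<zeta> :: complex:]) = 1 - monom 1 d"
proof (rule poly_eqI_degree)
  let ?U = "{\<zeta> :: complex. \<zeta> ^ d = 1}"
  have fin: "finite ?U" and card: "card ?U = d"
    using d by (auto intro: finite_roots_unity card_roots_unity_eq)
  have card': "card (insert 0 ?U) = d + 1"
    using fin card d by (subst card_insert_disjoint) (simp_all add: power_0_left)
  have "degree (\<Prod>\<zeta>\<in>?U. [:1, - \<zeta>:]) \<le> (\<Sum>\<zeta>\<in>?U. 1)"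
    using fin by (intro order.trans[OF degree_prod_sum_le] sum_mono) auto
  then show "degree (\<Prod>\<zeta>\<in>?U. [:1, - \<zeta>:]) < card (insert 0 ?U)"
    unfolding card' by (simp add: card)
  have "degree (1 - monom (1::complex) d) \<le> d"
    by (intro degree_diff_le degree_monom_le) simp
  then show "degree (1 - monom (1::complex) d) < card (insert 0 ?U)"
    unfolding card' by simp
  fix x assume x: "x \<in> insert 0 ?U"
  show "poly (\<Prod>\<zeta>\<in>?U. [:1, - \<zeta>:]) x = poly (1 - monom 1 d) x"
  proof (cases "x = 0")
    case True
    then show ?thesis using d by (simp add: poly_prod poly_monom)
  next
    case False
    with x have xd: "x ^ d = 1" by simp
    then have "inverse x \<in> ?U" by (simp add: power_inverse)
    moreover have "poly [:1, - inverse x:] x = 0" using False by simp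
    ultimately have "(\<Prod>\<zeta>\<in>?U. poly [:1, - \<zeta>:] x) = 0"
      using fin by (intro prod_zero) auto
    with xd show ?thesis by (simp add: poly_prod poly_monom)
  qed
qed

text \<open>
  Multiplying numerator and denominator of the generating function by the factors
  \<open>1 - \<zeta> * X\<close> of the \<open>d\<close>-th roots of unity \<open>\<zeta>\<close> missing from \<open>z ` I\<close> turns it into
  \<open>Q / (1 - X ^ d)\<close>, where \<open>Q\<close> has constant term \<open>1\<close> and degree less than \<open>d\<close> because at least
  one root is not missing. Hence the coefficients repeat with period \<open>d\<close>.
\<close>

lemma complete_homogeneous_distinct_roots_unity:
  fixes z :: "'a \<Rightarrow> complex"
  assumes d: "d > 0" and I: "finite I" "I \<noteq> {}"
    and z: "inj_on z I" "\<And>i. i \<in> I \<Longrightarrow> z i ^ d = 1"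
  shows "complete_homogeneous z I (t * d) = 1"
proof (induction t)
  case (Suc t)
  let ?U = "{\<zeta> :: complex. \<zeta> ^ d = 1}"
  let ?H = "Abs_fps (complete_homogeneous z I)"
  define Q where "Q = (\<Prod>\<zeta>\<in>?U - z ` I. [:1, - \<zeta>:])"
  have fin: "finite ?U" and card: "card ?U = d"
    using d by (auto intro: finite_roots_unity card_roots_unity_eq)
  have sub: "z ` I \<subseteq> ?U" using z(2) by auto
  have "degree Q \<le> (\<Sum>\<zeta>\<in>?U - z ` I. 1)"
    unfolding Q_def using fin by (intro order.trans[OF degree_prod_sum_le] sum_mono) auto
  also have "\<dots> = card (?U - z ` I)" by simp
  also have "\<dots> < card ?U"
    using sub I by (intro psubset_card_mono[OF fin]) auto
  finally have degQ: "degree Q < d" by (simp add: card)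
  have "1 - monom 1 d = (\<Prod>\<zeta>\<in>?U. [:1, - \<zeta>:])"
    using prod_one_minus_roots_unity[OF d] by simp
  also have "\<dots> = Q * (\<Prod>\<zeta>\<in>z ` I. [:1, - \<zeta>:])"
    unfolding Q_def by (rule prod.subset_diff[OF sub fin])
  also have "(\<Prod>\<zeta>\<in>z ` I. [:1, - \<zeta>:]) = (\<Prod>i\<in>I. [:1, - z i:])"
    by (simp add: prod.reindex[OF z(1)])
  finally have "?H * fps_of_poly (1 - monom 1 d)
      = (?H * fps_of_poly (\<Prod>i\<in>I. [:1, - z i:])) * fps_of_poly Q"
    by (simp add: fps_of_poly_mult mult_ac)
  then have "?H * (1 - fps_X ^ d) = fps_of_poly Q"
    using complete_homogeneous_fps[OF I(1), of z]
    by (simp add: fps_of_poly_diff fps_of_poly_monom)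
  then have "(?H * (1 - fps_X ^ d)) $ (Suc t * d) = coeff Q (Suc t * d)"
    by simp
  also have "\<dots> = 0" using degQ by (intro coeff_eq_0) simp
  also have "(?H * (1 - fps_X ^ d)) $ (Suc t * d)
      = complete_homogeneous z I (Suc t * d) - complete_homogeneous z I (t * d)"
    by (simp add: right_diff_distrib fps_X_power_mult_right_nth)
  finally show ?case using Suc by simp
qed simp

lemma power_eq_1_coprime:
  fixes x :: "'a::semiring_1"
  assumes "x ^ m = 1" "x ^ d = 1" "coprime m d" "m \<noteq> 0"
  shows "x = 1"
proof -
  obtain u v where uv: "m * u = d * v + 1"
    using bezout_nat[OF assms(4), of d] coprime_imp_gcd_eq_1[OF assms(3)] by metis
  have "1 = x ^ (m * u)" by (simp only: power_mult assms power_one)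
  also have "\<dots> = x ^ (d * v) * x" by (simp only: uv power_add power_one_right)
  also have "\<dots> = x" by (simp only: power_mult assms power_one mult_1)
  finally show ?thesis by simp
qed

text \<open>
  For \<open>m\<close> prime to \<open>d\<close> the \<open>m\<close>-th power permutes the \<open>d\<close>-th roots of unity, whose sum is \<open>0\<close>.
\<close>

lemma sum_power_roots_unity:
  assumes d: "prime d"
  shows "(\<Sum>\<zeta> | \<zeta> ^ d = 1. \<zeta> ^ m :: complex) = (if d dvd m then of_nat d else 0)"
proof (cases "d dvd m")
  case True
  have "(\<Sum>\<zeta> | \<zeta> ^ d = 1. \<zeta> ^ m :: complex) = (\<Sum>\<zeta> | \<zeta> ^ d = (1::complex). 1)"
    using True by (intro sum.cong) (auto simp: power_mult)
  with True d show ?thesis by (simp add: card_roots_unity_eq prime_gt_0_nat)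
next
  case False
  let ?U = "{\<zeta> :: complex. \<zeta> ^ d = 1}"
  have fin: "finite ?U" using d by (intro finite_roots_unity) (simp add: prime_gt_0_nat Suc_leI)
  have cop: "coprime m d" using False d by (simp add: coprime_commute prime_imp_coprime)
  have m0: "m \<noteq> 0" using False by (intro notI) simp
  have inj: "inj_on (\<lambda>\<zeta>. \<zeta> ^ m) ?U"
  proof (rule inj_onI)
    fix x y :: complex assume xy: "x \<in> ?U" "y \<in> ?U" "x ^ m = y ^ m"
    have y0: "y \<noteq> 0"
      using xy(2) d by (auto simp: power_0_left)
    then have "(x / y) ^ d = 1" "(x / y) ^ m = 1"
      using xy by (simp_all add: power_divide)
    with power_eq_1_coprime[OF _ _ cop m0] have "x / y = 1" by blast
    with y0 show "x = y" by simp
  qed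
  have "(\<zeta> ^ m) ^ d = 1" if "\<zeta> ^ d = 1" for \<zeta> :: complex
    by (metis that power_commutes power_mult mult.commute power_one)
  then have "(\<lambda>\<zeta>. \<zeta> ^ m) ` ?U = ?U"
    using fin inj by (intro endo_inj_surj) auto
  then have "(\<Sum>\<zeta>\<in>?U. \<zeta> ^ m) = \<Sum>?U"
    using sum.reindex[OF inj, of "\<lambda>x. x"] by simp
  also have "\<dots> = 0" by (rule sum_roots_unity[OF prime_gt_1_nat[OF d]])
  finally show ?thesis using False by simp
qed

text \<open>
  Averaging \<open>\<zeta> ^ m\<close> over the \<open>d\<close>-th roots of unity detects whether \<open>d\<close> divides the weight \<open>m\<close>.
  Exchanging the two sums, the root \<open>1\<close> contributes the number of all multisets of size
  \<open>t * d\<close>, while each of the \<open>d - 1\<close> other roots contributes exactly \<open>1\<close>: as \<open>d\<close> is prime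
  and the residues \<open>b i\<close> are distinct, the numbers \<open>\<zeta> ^ b i\<close> are distinct roots of unity.
\<close>

lemma card_zero_weight_multisets:
  fixes b :: "'a \<Rightarrow> nat"
  assumes d: "prime d" and I: "finite I" "I \<noteq> {}"
    and b: "inj_on b I" "b ` I \<subseteq> {..<d}"
  shows "d * card {M \<in> multisets_of_size I (t * d). d dvd (\<Sum>i\<in>#M. b i)}
       = (card I + t * d - 1 choose (t * d)) + (d - 1)"
proof -
  let ?W = "multisets_of_size I (t * d)"
  let ?U = "{\<zeta> :: complex. \<zeta> ^ d = 1}"
  have d1: "d > 1" using d by (rule prime_gt_1_nat)
  have finW: "finite ?W" using I(1) by (rule finite_multisets_of_size)
  have fin: "finite ?U" and card: "card ?U = d"
    using d1 by (auto intro: finite_roots_unity card_roots_unity_eq)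
  have h: "(\<Sum>M\<in>?W. \<zeta> ^ (\<Sum>i\<in>#M. b i)) = complete_homogeneous (\<lambda>i. \<zeta> ^ b i) I (t * d)"
    for \<zeta> :: complex
  proof -
    have "\<zeta> ^ (\<Sum>i\<in>#M. b i) = (\<Prod>i\<in>#M. \<zeta> ^ b i)" for M
      by (induction M) (simp_all add: power_add)
    then show ?thesis by (simp add: complete_homogeneous_def)
  qed
  have h1: "complete_homogeneous (\<lambda>i. \<zeta> ^ b i) I (t * d) = 1"
    if \<zeta>: "\<zeta> ^ d = 1" "\<zeta> \<noteq> 1" for \<zeta> :: complex
  proof (rule complete_homogeneous_distinct_roots_unity)
    have \<zeta>0: "\<zeta> \<noteq> 0" using \<zeta>(1) d1 by (auto simp: power_0_left)
    have lt: "\<not> (b i < b j \<and> \<zeta> ^ b i = \<zeta> ^ b j)" if "j \<in> I" for i j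
    proof
      assume ij: "b i < b j \<and> \<zeta> ^ b i = \<zeta> ^ b j"
      then have "\<zeta> ^ (b j - b i) = 1" using \<zeta>0 by (simp add: power_diff)
      moreover have "\<not> d dvd b j - b i"
        using ij b(2) that by (auto dest!: dvd_imp_le)
      then have "coprime (b j - b i) d"
        using d by (simp add: coprime_commute prime_imp_coprime)
      ultimately have "\<zeta> = 1"
        using power_eq_1_coprime[OF _ \<zeta>(1)] ij by simp
      with \<zeta>(2) show False by simp
    qed
    show "inj_on (\<lambda>i. \<zeta> ^ b i) I"
    proof (rule inj_onI)
      fix i j assume "i \<in> I" "j \<in> I" "\<zeta> ^ b i = \<zeta> ^ b j"
      with lt[of i j] lt[of j i] b(1) show "i = j"
        by (metis inj_onD linorder_neqE_nat)
    qed
    show "(\<zeta> ^ b i) ^ d = 1" for i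
      by (metis \<zeta>(1) mult.commute power_mult power_one)
  qed (use I d1 in auto)
  have "of_nat (d * card {M \<in> ?W. d dvd (\<Sum>i\<in>#M. b i)})
      = (\<Sum>M\<in>?W. if d dvd (\<Sum>i\<in>#M. b i) then of_nat d else (0::complex))"
    using finW by (simp add: sum.If_cases Int_def mult.commute)
  also have "\<dots> = (\<Sum>M\<in>?W. \<Sum>\<zeta>\<in>?U. \<zeta> ^ (\<Sum>i\<in>#M. b i))"
    using sum_power_roots_unity[OF d] by simp
  also have "\<dots> = (\<Sum>\<zeta>\<in>?U. complete_homogeneous (\<lambda>i. \<zeta> ^ b i) I (t * d))"
    unfolding h[symmetric] by (rule sum.swap)
  also have "\<dots> = complete_homogeneous (\<lambda>i. 1 ^ b i) I (t * d)
      + (\<Sum>\<zeta>\<in>?U - {1}. complete_homogeneous (\<lambda>i. \<zeta> ^ b i) I (t * d))"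
    using fin by (intro sum.remove) auto
  also have "(\<Sum>\<zeta>\<in>?U - {1}. complete_homogeneous (\<lambda>i. \<zeta> ^ b i) I (t * d)) = of_nat (d - 1)"
    using h1 card by (simp add: card_Diff_singleton)
  also have "complete_homogeneous (\<lambda>i. 1 ^ b i) I (t * d) = (of_nat (card ?W) :: complex)"
    by (simp add: complete_homogeneous_def)
  finally have "d * card {M \<in> ?W. d dvd (\<Sum>i\<in>#M. b i)} = card ?W + (d - 1)"
    by (simp only: of_nat_eq_iff flip: of_nat_add)
  then show ?thesis by (simp add: card_multisets_of_size[OF I(1)])
qed

section \<open>Sumsets of zero-weight multisets\<close>

lemma sumset_Suc: "sumset (Suc t) A = {x + y |x y. x \<in> A \<and> y \<in> sumset t A}"
proof (intro set_eqI iffI)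
  fix v assume "v \<in> sumset (Suc t) A"
  then obtain xs where "v = sum_list xs" "length xs = Suc t" "set xs \<subseteq> A"
    by (auto simp: sumset_def)
  then show "v \<in> {x + y |x y. x \<in> A \<and> y \<in> sumset t A}"
    by (cases xs) (auto simp: sumset_def)
next
  fix v assume "v \<in> {x + y |x y. x \<in> A \<and> y \<in> sumset t A}"
  then obtain x xs where "v = x + sum_list xs" "x \<in> A" "length xs = t" "set xs \<subseteq> A"
    by (auto simp: sumset_def)
  then have "v = sum_list (x # xs) \<and> length (x # xs) = Suc t \<and> set (x # xs) \<subseteq> A" by simp
  then show "v \<in> sumset (Suc t) A" unfolding sumset_def by blast
qed

lemma sumset_image_additive:
  assumes "f 0 = 0" "\<And>x y. f (x + y) = f x + f y"
  shows "sumset t (f ` A) = f ` sumset t A"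
proof (induction t)
  case (Suc t)
  show ?case unfolding sumset_Suc Suc.IH by (force simp: assms(2))
qed (simp add: sumset_0 assms(1))

definition zero_weight_multisets :: "nat \<Rightarrow> ('a \<Rightarrow> nat) \<Rightarrow> 'a set \<Rightarrow> nat \<Rightarrow> 'a multiset set" where
  "zero_weight_multisets d b I k = {M \<in> multisets_of_size I k. d dvd (\<Sum>i\<in>#M. b i)}"

text \<open>
  A zero-weight multiset of size \<open>t * d\<close> splits into \<open>t\<close> zero-weight multisets of size \<open>d\<close>: as
  long as \<open>t \<ge> 2\<close> it has at least \<open>2 * d - 1\<close> elements, so by the theorem of Erdos, Ginzburg and
  Ziv a part of size \<open>d\<close> and zero weight can be removed, and what remains again has zero weight.
\<close>

lemma sumset_zero_weight_multisets:
  fixes b :: "'a \<Rightarrow> nat"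
  assumes d: "prime d"
  shows "sumset t (zero_weight_multisets d b I d) = zero_weight_multisets d b I (t * d)"
proof (induction t)
  case 0
  show ?case by (auto simp: sumset_0 zero_weight_multisets_def)
next
  case (Suc t)
  let ?Z = "zero_weight_multisets d b I"
  show ?case unfolding sumset_Suc Suc.IH
  proof (intro set_eqI iffI)
    fix M assume "M \<in> {x + y |x y. x \<in> ?Z d \<and> y \<in> ?Z (t * d)}"
    then show "M \<in> ?Z (Suc t * d)"
      by (auto simp: zero_weight_multisets_def multisets_of_size_def)
  next
    fix M assume M: "M \<in> ?Z (Suc t * d)"
    show "M \<in> {x + y |x y. x \<in> ?Z d \<and> y \<in> ?Z (t * d)}"
    proof (cases t)
      case 0
      with M have "M = M + {#}" "M \<in> ?Z d" "{#} \<in> ?Z (t * d)"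
        by (auto simp: zero_weight_multisets_def)
      then show ?thesis by blast
    next
      case (Suc s)
      with M have "2 * d - 1 \<le> size M"
        by (auto simp: zero_weight_multisets_def multisets_of_size_def)
      then obtain N where N: "N \<subseteq># M" "size N = d" "int d dvd (\<Sum>x\<in>#N. int (b x))"
        using erdos_ginzburg_ziv_prime_mset[OF d, of M "\<lambda>x. int (b x)"] by blast
      have int_sum: "(\<Sum>x\<in>#N. int (b x)) = int (\<Sum>x\<in>#N. b x)"
        by (induction N) simp_all
      have dN: "d dvd (\<Sum>x\<in>#N. b x)"
        using N(3) by (simp only: int_sum int_dvd_int_iff)
      have split: "M = N + (M - N)" using N(1) by simp
      then have "(\<Sum>x\<in>#M. b x) = (\<Sum>x\<in>#N. b x) + (\<Sum>x\<in>#M - N. b x)"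
        by (metis image_mset_union sum_mset.union)
      moreover have "d dvd (\<Sum>x\<in>#M. b x)" using M by (simp add: zero_weight_multisets_def)
      ultimately have "d dvd (\<Sum>x\<in>#M - N. b x)" using dN by (simp add: dvd_add_right_iff)
      then have "N \<in> ?Z d" "M - N \<in> ?Z (t * d)"
        using M N dN set_mset_mono[OF N(1)]
        by (auto simp: zero_weight_multisets_def multisets_of_size_def size_Diff_submset dest: in_diffD)
      with split show ?thesis by blast
    qed
  qed
qed

section \<open>The GT-subset\<close>

text \<open>
  A solution \<open>(y\<^sub>0, \<dots>, y\<^sub>n)\<close> is encoded as the multiset over \<open>{0..n}\<close> in which \<open>i\<close> has
  multiplicity \<open>y\<^sub>i\<close>; this map drops the coordinate \<open>y\<^sub>0\<close>.
\<close>

definition dehomogenize :: "nat multiset \<Rightarrow> nat \<Rightarrow> nat" where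
  "dehomogenize M = (\<lambda>i. if i = 0 then 0 else count M i)"

text \<open>
  The dropped coordinate is recovered from the total size.
\<close>

lemma inj_on_dehomogenize: "inj_on dehomogenize (multisets_of_size I k)"
proof (rule inj_onI)
  fix M N assume MN: "M \<in> multisets_of_size I k" "N \<in> multisets_of_size I k"
    and eq: "dehomogenize M = dehomogenize N"
  let ?pos = "filter_mset (\<lambda>i. i \<noteq> 0)"
  have count_pos: "count M i = count N i" if "i \<noteq> 0" for i
    using fun_cong[OF eq, of i] that by (simp add: dehomogenize_def)
  then have "?pos M = ?pos N" by (simp add: multiset_eq_iff)
  moreover have "size L = count L 0 + size (?pos L)" for L :: "nat multiset"
    by (induction L) auto
  moreover have "size M = size N" using MN by (simp add: multisets_of_size_def)
  ultimately have "count M 0 = count N 0" by (metis add_right_cancel)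
  with count_pos show "M = N" by (metis multiset_eqI)
qed

lemma sum_mset_eq_sum_count:
  fixes f :: "'a \<Rightarrow> nat"
  assumes "finite I" "set_mset M \<subseteq> I"
  shows "(\<Sum>i\<in>#M. f i) = (\<Sum>i\<in>I. count M i * f i)"
  using assms(2)
proof (induction M)
  case (add x M)
  have "(\<Sum>i\<in>I. count (add_mset x M) i * f i)
      = (\<Sum>i\<in>I. count M i * f i + (if i = x then f x else 0))"
    by (intro sum.cong) auto
  with add assms(1) show ?case by (simp add: sum.distrib)
qed simp

text \<open>
  Giving the index \<open>0\<close> the weight \<open>0\<close> makes the weight of a multiset equal to
  \<open>a 1 * y\<^sub>1 + \<dots> + a n * y\<^sub>n\<close>, whatever the value of \<open>y\<^sub>0\<close>.
\<close>

lemma GT_subset_eq_dehomogenize: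
  fixes a :: "nat \<Rightarrow> int"
  assumes a: "\<And>i. i \<in> {1..n} \<Longrightarrow> 0 \<le> a i"
  shows "GT_subset n d a
    = dehomogenize ` zero_weight_multisets d (\<lambda>i. if i = 0 then 0 else nat (a i)) {0..n} d"
    (is "_ = dehomogenize ` ?Z")
proof -
  let ?b = "\<lambda>i. if i = 0 then 0 else nat (a i)"
  have sum_0n: "(\<Sum>i\<in>{0..n}. f i) = f 0 + (\<Sum>i=1..n. f i)" for f :: "nat \<Rightarrow> nat"
    by (simp add: sum.atLeast_Suc_atMost)
  have mem: "M \<in> ?Z \<longleftrightarrow> set_mset M \<subseteq> {0..n} \<and> count M 0 + (\<Sum>i=1..n. count M i) = d
      \<and> [(\<Sum>i=1..n. a i * int (count M i)) = 0] (mod int d)" for M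
  proof (cases "set_mset M \<subseteq> {0..n}")
    case True
    have size: "size M = count M 0 + (\<Sum>i=1..n. count M i)"
      using sum_mset_eq_sum_count[OF _ True, of "\<lambda>_. 1"] by (simp add: sum_0n del: atLeast0AtMost)
    have "int (\<Sum>i\<in>#M. ?b i) = (\<Sum>i=1..n. int (count M i * ?b i))"
      by (subst sum_mset_eq_sum_count[OF _ True], simp, subst sum_0n) simp
    also have "\<dots> = (\<Sum>i=1..n. a i * int (count M i))"
      using a by (intro sum.cong) auto
    finally have weight: "int (\<Sum>i\<in>#M. ?b i) = (\<Sum>i=1..n. a i * int (count M i))" .
    have "d dvd (\<Sum>i\<in>#M. ?b i) \<longleftrightarrow> int d dvd int (\<Sum>i\<in>#M. ?b i)"
      by (simp only: int_dvd_int_iff)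
    then have "d dvd (\<Sum>i\<in>#M. ?b i) \<longleftrightarrow> [(\<Sum>i=1..n. a i * int (count M i)) = 0] (mod int d)"
      by (simp only: weight cong_0_iff)
    with True size show ?thesis by (simp add: zero_weight_multisets_def multisets_of_size_def)
  qed (simp add: zero_weight_multisets_def multisets_of_size_def)
  show ?thesis
  proof (intro set_eqI iffI)
    fix y assume "y \<in> GT_subset n d a"
    then obtain y0 where y: "\<And>i. i \<notin> {1..n} \<Longrightarrow> y i = 0" "y0 + (\<Sum>i=1..n. y i) = d"
      "[(\<Sum>i=1..n. a i * int (y i)) = 0] (mod int d)"
      by (auto simp: GT_subset_def)
    \<comment> \<open>The multiset that restores the coordinate \<open>y0\<close>.\<close>
    define M where "M = Abs_multiset (y(0 := y0))"
    have supp: "{i. (y(0 := y0)) i > 0} \<subseteq> {0..n}"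
    proof
      fix i assume "i \<in> {i. (y(0 := y0)) i > 0}"
      with y(1)[of i] show "i \<in> {0..n}" by (cases "i = 0") fastforce+
    qed
    then have "finite {i. (y(0 := y0)) i > 0}" by (rule finite_subset) simp
    then have count: "count M = y(0 := y0)" unfolding M_def by (rule count_Abs_multiset)
    then have "set_mset M \<subseteq> {0..n}" using supp by (simp add: set_mset_def)
    moreover have "count M i = y i" if "i \<in> {1..n}" for i using that count by simp
    ultimately have "M \<in> ?Z" unfolding mem using y(2,3) count by simp
    moreover have "y = dehomogenize M"
      using y(1)[of 0] by (auto simp: dehomogenize_def count)
    ultimately show "y \<in> dehomogenize ` ?Z" by blast
  next
    fix y assume "y \<in> dehomogenize ` ?Z"
    then obtain M where M: "M \<in> ?Z" "y = dehomogenize M" by blast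
    have pos: "y i = count M i" if "i \<in> {1..n}" for i
      using that by (simp add: M(2) dehomogenize_def)
    have zero: "y i = 0" if "i \<notin> {1..n}" for i
    proof (cases "i = 0")
      case False
      with that have "i \<notin> {0..n}" by simp
      with M(1) have "i \<notin># M" unfolding mem by blast
      then show ?thesis by (simp add: M(2) dehomogenize_def not_in_iff)
    qed (simp add: M(2) dehomogenize_def)
    have "(\<Sum>i=1..n. y i) = (\<Sum>i=1..n. count M i)"
      "(\<Sum>i=1..n. a i * int (y i)) = (\<Sum>i=1..n. a i * int (count M i))"
      by (intro sum.cong refl; simp add: pos)+
    with M(1) have "count M 0 + (\<Sum>i=1..n. y i) = d"
      "[(\<Sum>i=1..n. a i * int (y i)) = 0] (mod int d)"
      unfolding mem by simp_all
    with zero show "y \<in> GT_subset n d a"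
      unfolding GT_subset_def by blast
  qed
qed

text \<open>
  The polynomial is \<open>(d * X + 1) * \<dots> * (d * X + n) / n!\<close>.
\<close>

lemma binomial_linear_eq_poly:
  fixes d n :: nat
  obtains P :: "rat poly"
  where "\<And>t. poly P (of_nat t) = of_nat (t * d + n choose n)"
proof
  fix t
  have "poly (\<Prod>i=1..n. [:of_nat i, of_nat d:]) (of_nat t) = (\<Prod>i=1..n. of_nat (t * d + i) :: rat)"
    by (simp add: poly_prod algebra_simps)
  also have "\<dots> = pochhammer (of_nat (t * d) + 1) n"
    by (simp add: pochhammer_prod prod.atLeast1_atMost_eq atLeast0LessThan algebra_simps)
  finally show "poly (smult (1 / fact n) (\<Prod>i=1..n. [:of_nat i, of_nat d:])) (of_nat t)
      = (of_nat (t * d + n choose n) :: rat)"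
    by (simp add: binomial_gbinomial gbinomial_pochhammer')
qed

text \<open>
  The weights \<open>0, a 1, \<dots>, a n\<close> are distinct elements of \<open>{..<d}\<close>, which is what the count of
  zero-weight multisets requires.
\<close>

lemma sumset_card_GT_subset:
  assumes "prime d" "0 < a 1" "strict_mono_on {1..n} a" "a n < int d"
  shows "d * sumset_card (GT_subset n d a) t = (t * d + n choose n) + (d - 1)"
proof -
  define b where "b i = (if i = 0 then 0 else nat (a i))" for i
  let ?Z = "zero_weight_multisets d b {0..n}"
  have d0: "d > 0" using assms(1) by (rule prime_gt_0_nat)
  have pos: "0 < a i" "a i < int d" if "i \<in> {1..n}" for i
    using that assms strict_mono_on_leD[OF assms(3), of 1 i] strict_mono_on_leD[OF assms(3), of i n]
    by force+
  have "inj_on b {0..n}"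
  proof (rule inj_onI)
    fix i j assume ij: "i \<in> {0..n}" "j \<in> {0..n}" "b i = b j"
    have "b k = 0 \<longleftrightarrow> k = 0" if "k \<in> {0..n}" for k
      using pos(1)[of k] that by (auto simp: b_def)
    then have "i = 0 \<longleftrightarrow> j = 0" using ij by metis
    moreover have "i = j" if "i \<noteq> 0" "j \<noteq> 0"
    proof -
      have "a i = a j" using ij that pos[of i] pos[of j] by (auto simp: b_def)
      then show ?thesis
        using ij that strict_mono_on_imp_inj_on[OF assms(3)] by (auto dest!: inj_onD)
    qed
    ultimately show "i = j" by auto
  qed
  moreover have "b i < d" if "i \<in> {0..n}" for i
    using d0 pos[of i] that by (cases "i = 0") (simp_all add: b_def nat_less_iff)
  then have "b ` {0..n} \<subseteq> {..<d}" by auto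
  ultimately have count: "d * card (?Z (t * d)) = (n + 1 + t * d - 1 choose (t * d)) + (d - 1)"
    using card_zero_weight_multisets[OF assms(1), of "{0..n}" b t]
    by (simp add: zero_weight_multisets_def)
  have "GT_subset n d a = dehomogenize ` ?Z d"
    unfolding b_def using pos by (intro GT_subset_eq_dehomogenize) (simp add: less_imp_le)
  then have "sumset t (GT_subset n d a) = dehomogenize ` sumset t (?Z d)"
    by (simp only:) (intro sumset_image_additive; simp add: dehomogenize_def fun_eq_iff)
  also have "\<dots> = dehomogenize ` ?Z (t * d)"
    by (simp only: sumset_zero_weight_multisets[OF assms(1)])
  also have "card \<dots> = card (?Z (t * d))"
    by (intro card_image inj_on_subset[OF inj_on_dehomogenize])
       (auto simp: zero_weight_multisets_def)
  finally show ?thesis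
    using count binomial_symmetric[of n "t * d + n"] by (simp add: sumset_card_def add.commute)
qed

theorem proposition5p5:
  fixes n d :: nat and a :: "nat \<Rightarrow> int"
  assumes "2 \<le> n" and "n < d" and "prime d"
    and "0 < a 1" and "strict_mono_on {1..n} a" and "a n < int d"
  shows "phase_transition (GT_subset n d a) = 0 \<and>
    (\<forall>t. of_nat (sumset_card (GT_subset n d a) t) = poly (sumset_poly (GT_subset n d a)) (of_nat t) \<and>
         poly (sumset_poly (GT_subset n d a)) (of_nat t) =
           1 / of_nat d * of_nat ((t * d + n) choose n) + (of_nat d - 1) / of_nat d)"
proof -
  let ?A = "GT_subset n d a"
  have d0: "d > 0" using assms(3) by (rule prime_gt_0_nat)
  obtain P :: "rat poly" where P: "\<And>t. poly P (of_nat t) = of_nat (t * d + n choose n)"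
    using binomial_linear_eq_poly by blast
  define p where "p = smult (1 / of_nat d) P + [:(of_nat d - 1) / of_nat d:]"
  have p: "poly p (of_nat t) = 1 / of_nat d * of_nat ((t * d + n) choose n) + (of_nat d - 1) / of_nat d"
    for t by (simp add: p_def P)
  have card: "of_nat (sumset_card ?A t) = poly p (of_nat t)" for t
  proof -
    have "of_nat d * of_nat (sumset_card ?A t) = (of_nat (t * d + n choose n) + (of_nat d - 1) :: rat)"
      using arg_cong[OF sumset_card_GT_subset[OF assms(3-6), of t], of "of_nat :: nat \<Rightarrow> rat"] d0
      by (simp add: of_nat_diff)
    then have "of_nat (sumset_card ?A t) = (of_nat (t * d + n choose n) + (of_nat d - 1)) / (of_nat d :: rat)"
      using d0 by (simp add: nonzero_eq_divide_eq mult.commute)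
    then show ?thesis by (simp add: p add_divide_distrib)
  qed
  have "sumset_poly ?A = p"
    unfolding sumset_poly_def
  proof (rule the_equality)
    show "\<forall>\<^sub>F t in sequentially. of_nat (sumset_card ?A t) = poly p (of_nat t)"
      using card by simp
    then show "q = p" if "\<forall>\<^sub>F t in sequentially. of_nat (sumset_card ?A t) = poly q (of_nat t)" for q
      using that by (rule sumset_poly_unique[rotated])
  qed
  with card p show ?thesis
    by (simp add: phase_transition_def Least_eq_0)
qed

end
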